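(* For any finite set $\mathcal{M}$, any finite-dimensional Hilbert space $\mathcal{H}$, and any ensemble $\boldsymbol{\rho} \in \mathcal{E}(\mathcal{M},\mathcal{H})$, if there exists a numbering $\mathbf{n}^* \in \mathcal{N}_{\mathcal{M}}$ such that $$\left| E_{\boldsymbol{\rho}}(\mathbf{n}^* ) \right| \ge E_{\boldsymbol{\rho}}(\mathbf{n}) \quad \text{for any } \mathbf{n} \in \mathcal{N}_{\mathcal{M}},$$ then the numbering-valued measurement $\boldsymbol{\pi}_{\boldsymbol{\rho},\mathbf{n}^*} \in \mathcal{P}(\mathcal{N}_{\mathcal{M}},\mathcal{H})$ minimizes the guesswork, that is, $$G_{\min}(\boldsymbol{\rho}) = G(\boldsymbol{\rho}, \boldsymbol{\pi}_{\boldsymbol{\rho},\mathbf{n}^*}).$$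
   Context: $\mathcal{L}(\mathcal{H})$ is the space of Hermitian operators on $\mathcal{H}$, $\mathcal{L}_+(\mathcal{H})$ the cone of positive semidefinite operators on $\mathcal{H}$, $\mathbb{1}$ the identity. For Hermitian $A,B$, $A \ge B$ means $A-B$ is positive semidefinite; $|A|$ is the operator absolute value; $\Pi_-(A)$ and $\Pi_0(A)$ are the projectors on the negative and null parts of $A$, i.e. onto the span of the eigenvectors of $A$ with negative eigenvalue and onto the kernel of $A$, respectively. For a finite set $\mathcal{M}$: - $\mathcal{N}_{\mathcal{M}}$ is the set of numberings, i.e. bijections $\mathbf{n}:\{1,\dots,|\mathcal{M}|\}\to\mathcal{M}$. The reversed numbering is $\overline{\mathbf{n}}(t) := \mathbf{n}(|\mathcal{M}|+1-t)$. - $\mathcal{E}(\mathcal{M},\mathcal{H})$ is the set of ensembles, i.e. maps $\boldsymbol{\rho}:\mathcal{M}\to\mathcal{L}_+(\mathcal{H})$ with $\sum_{m\in\mathcal{M}}\operatorname{Tr}[\boldsymbol{\rho}(m)]=1$. - $\mathcal{P}(\mathcal{N}_{\mathcal{M}},\mathcal{H})$ is the set of numbering-valued measurements, i.e. maps $\boldsymbol{\pi}:\mathcal{N}_{\mathcal{M}}\to\mathcal{L}_+(\mathcal{H})$ with $\sum_{\mathbf{n}\in\mathcal{N}_{\mathcal{M}}}\boldsymbol{\pi}(\mathbf{n})=\mathbb{1}$. The guesswork is $G(\boldsymbol{\rho},\boldsymbol{\pi}) := \sum_{t=1}^{|\mathcal{M}|} t\, q_{\boldsymbol{\rho},\boldsymbol{\pi}}(t)$,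 where $q_{\boldsymbol{\rho},\boldsymbol{\pi}}(t) := \sum_{\mathbf{n}\in\mathcal{N}_{\mathcal{M}}}\operatorname{Tr}[\boldsymbol{\rho}(\mathbf{n}(t))\,\boldsymbol{\pi}(\mathbf{n})]$. The minimum guesswork is $G_{\min}(\boldsymbol{\rho}) := \min_{\boldsymbol{\pi}\in\mathcal{P}(\mathcal{N}_{\mathcal{M}},\mathcal{H})} G(\boldsymbol{\rho},\boldsymbol{\pi})$. The map $E_{\boldsymbol{\rho}}:\mathcal{N}_{\mathcal{M}}\to\mathcal{L}(\mathcal{H})$ is $E_{\boldsymbol{\rho}}(\mathbf{n}) := \sum_{t=1}^{|\mathcal{M}|}(2t-|\mathcal{M}|-1)\,\boldsymbol{\rho}(\mathbf{n}(t))$. For $\mathbf{n}^*\in\mathcal{N}_{\mathcal{M}}$, the numbering-valued measurement $\boldsymbol{\pi}_{\boldsymbol{\rho},\mathbf{n}^*}$ is given by $\boldsymbol{\pi}_{\boldsymbol{\rho},\mathbf{n}^*}(\mathbf{n}) := \Pi_-(E_{\boldsymbol{\rho}}(\mathbf{n})) + \tfrac12 \Pi_0(E_{\boldsymbol{\rho}}(\mathbf{n}))$ if $\mathbf{n}\in\{\mathbf{n}^*,\overline{\mathbf{n}^*}\}$, and $0$ otherwise.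
   Formalization: The set M is additionally assumed not to have exactly one element; for |M| = 1 the numbering n* equals its reversal, E(n* ) = 0, and the defined map is half the identity, which is not a measurement (G would be 1/2 while the minimum guesswork is 1). *)

theory Defs
  imports
    "Jordan_Normal_Form.Schur_Decomposition"
    "Jordan_Normal_Form.Matrix_Kernel"
    "HOL-Library.FuncSet"
begin

text \<open>
  A finite-dimensional Hilbert space is taken to be \<open>\<complex>\<^sup>d\<close> for an arbitrary natural number \<open>d\<close>,
  with the inner product \<open>(\<bullet>c)\<close>; operators on it are the matrices in \<open>carrier_mat d d\<close>.
\<close>

definition hermitian_mat :: "nat \<Rightarrow> complex mat \<Rightarrow> bool" where
  "hermitian_mat d A \<longleftrightarrow> A \<in> carrier_mat d d \<and> mat_adjoint A = A"

definition psd_mat :: "nat \<Rightarrow> complex mat \<Rightarrow> bool" where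
  "psd_mat d A \<longleftrightarrow> hermitian_mat d A \<and> (\<forall>v \<in> carrier_vec d. 0 \<le> Re ((A *\<^sub>v v) \<bullet>c v))"

definition loewner_ge :: "nat \<Rightarrow> complex mat \<Rightarrow> complex mat \<Rightarrow> bool" where
  "loewner_ge d A B \<longleftrightarrow> psd_mat d (A - B)"

definition mat_trace :: "complex mat \<Rightarrow> complex" where
  "mat_trace A = (\<Sum>i<dim_row A. A $$ (i, i))"

text \<open>Matrices of varying dimension form no additive monoid type, hence an entrywise sum.\<close>

definition mat_sum :: "nat \<Rightarrow> ('i \<Rightarrow> complex mat) \<Rightarrow> 'i set \<Rightarrow> complex mat" where
  "mat_sum d F I = mat d d (\<lambda>(i, j). \<Sum>k\<in>I. F k $$ (i, j))"

text \<open>\<open>|A|\<close> is the unique positive semidefinite square root of \<open>A\<^sup>* A\<close>.\<close>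

definition mat_abs :: "nat \<Rightarrow> complex mat \<Rightarrow> complex mat" where
  "mat_abs d A = (THE B. psd_mat d B \<and> B * B = mat_adjoint A * A)"

definition span_vecs :: "nat \<Rightarrow> complex vec set \<Rightarrow> complex vec set" where
  "span_vecs d S = LinearCombinations.module.span class_ring (module_vec TYPE(complex) d) S"

text \<open>The orthogonal projector onto a linear subspace \<open>S\<close> of \<open>\<complex>\<^sup>d\<close>.\<close>

definition orth_projector :: "nat \<Rightarrow> complex vec set \<Rightarrow> complex mat" where
  "orth_projector d S =
     (THE P. hermitian_mat d P \<and> P * P = P \<and> (\<lambda>v. P *\<^sub>v v) ` carrier_vec d = S)"

definition neg_projector :: "nat \<Rightarrow> complex mat \<Rightarrow> complex mat" where
  "neg_projector d A =
     orth_projector d (span_vecs d {v. \<exists>r::real. r < 0 \<and> eigenvector A v (complex_of_real r)})"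

definition null_projector :: "nat \<Rightarrow> complex mat \<Rightarrow> complex mat" where
  "null_projector d A = orth_projector d (mat_kernel A)"

text \<open>
  Numberings are extensional (\<open>undefined\<close> outside \<open>{1..card M}\<close>), so that each bijection
  \<open>{1..card M} \<rightarrow> M\<close> is represented by exactly one function and \<open>numberings M\<close> is finite.
\<close>

definition numberings :: "'m set \<Rightarrow> (nat \<Rightarrow> 'm) set" where
  "numberings M = {n \<in> extensional {1..card M}. bij_betw n {1..card M} M}"

definition reversed :: "'m set \<Rightarrow> (nat \<Rightarrow> 'm) \<Rightarrow> (nat \<Rightarrow> 'm)" where
  "reversed M n = (\<lambda>t \<in> {1..card M}. n (card M + 1 - t))"

definition ensembles :: "'m set \<Rightarrow> nat \<Rightarrow> ('m \<Rightarrow> complex mat) set" where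
  "ensembles M d = {\<rho>. (\<forall>m\<in>M. psd_mat d (\<rho> m)) \<and> (\<Sum>m\<in>M. mat_trace (\<rho> m)) = 1}"

definition measurements :: "'m set \<Rightarrow> nat \<Rightarrow> ((nat \<Rightarrow> 'm) \<Rightarrow> complex mat) set" where
  "measurements M d =
     {\<pi>. (\<forall>n \<in> numberings M. psd_mat d (\<pi> n)) \<and> mat_sum d \<pi> (numberings M) = 1\<^sub>m d}"

text \<open>The trace of a product of two Hermitian matrices is real, so \<open>Re\<close> is a mere type conversion.\<close>

definition guess_prob ::
    "'m set \<Rightarrow> ('m \<Rightarrow> complex mat) \<Rightarrow> ((nat \<Rightarrow> 'm) \<Rightarrow> complex mat) \<Rightarrow> nat \<Rightarrow> real" where
  "guess_prob M \<rho> \<pi> t = (\<Sum>n \<in> numberings M. Re (mat_trace (\<rho> (n t) * \<pi> n)))"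

definition guesswork ::
    "'m set \<Rightarrow> ('m \<Rightarrow> complex mat) \<Rightarrow> ((nat \<Rightarrow> 'm) \<Rightarrow> complex mat) \<Rightarrow> real" where
  "guesswork M \<rho> \<pi> = (\<Sum>t = 1..card M. real t * guess_prob M \<rho> \<pi> t)"

text \<open>A genuine minimum; \<open>Min\<close> is not applicable as the set of values is infinite in general.\<close>

definition min_guesswork :: "'m set \<Rightarrow> nat \<Rightarrow> ('m \<Rightarrow> complex mat) \<Rightarrow> real" where
  "min_guesswork M d \<rho> = (LEAST g. g \<in> guesswork M \<rho> ` measurements M d)"

definition E_op :: "'m set \<Rightarrow> nat \<Rightarrow> ('m \<Rightarrow> complex mat) \<Rightarrow> (nat \<Rightarrow> 'm) \<Rightarrow> complex mat" where
  "E_op M d \<rho> n =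
     mat_sum d (\<lambda>t. complex_of_real (2 * real t - real (card M) - 1) \<cdot>\<^sub>m \<rho> (n t)) {1..card M}"

definition opt_measurement ::
    "'m set \<Rightarrow> nat \<Rightarrow> ('m \<Rightarrow> complex mat) \<Rightarrow> (nat \<Rightarrow> 'm) \<Rightarrow> (nat \<Rightarrow> 'm) \<Rightarrow> complex mat" where
  "opt_measurement M d \<rho> n' n =
     (if n \<in> {n', reversed M n'}
      then neg_projector d (E_op M d \<rho> n) + (1 / 2) \<cdot>\<^sub>m null_projector d (E_op M d \<rho> n)
      else 0\<^sub>m d d)"

end

theory Submission
  imports Defs "Jordan_Normal_Form.Spectral_Radius"
begin

text \<open>
  The guess probabilities \<open>q(t)\<close> sum to \<open>1\<close>, so the guesswork of \<open>\<pi>\<close> equals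
  \<open>(|M| + 1 + \<Sum>n. Tr[E(n) \<pi>(n)]) / 2\<close>. Reversing a numbering flips the sign of \<open>E\<close>, hence the
  hypothesis also gives \<open>E(n) \<ge> -|E(n')|\<close>, and the sum is at least \<open>-Tr |E(n')|\<close>. The
  measurement supported on \<open>n'\<close> and its reversal attains this value: diagonalising \<open>E(n')\<close> turns
  all operators involved into functions of its eigenvalues.
\<close>

section \<open>Spectral theorem for Hermitian matrices\<close>

text \<open>The weight 2t - |M| - 1 in \<open>E_op\<close> is the rank t, doubled and centred: it is
  odd under t -> |M| + 1 - t, and undoing the scaling leaves the constant (|M| + 1) / 2. The
  operator |E(n')| acts as a dual certificate: it dominates every E(n) and, through reversal, every
  -E(n), and minus its trace is exactly what the proposed measurement reaches. The obstacle is that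
  \<open>mat_abs\<close> and \<open>orth_projector\<close> are definite descriptions, so each needs
  a uniqueness argument before it can be computed. After that, all facts about n' and its reversal
  are real identities at a single eigenvalue. The kernel of E(n') is also that of -E(n'), so the two
  outcomes share it, half each. This takes two distinct outcomes: for |M| = 1 the numbering is its
  own reversal, E vanishes, and the only nonzero outcome would be half the identity. Hence
  \<open>card M \<noteq> 1\<close>.\<close>

lemma mat_adjoint_carrier [simp, intro]:
  "A \<in> carrier_mat n m \<Longrightarrow> mat_adjoint A \<in> carrier_mat m n"
  unfolding mat_adjoint_def by (auto intro: carrier_matI)

lemma dim_mat_adjoint [simp]:
  "dim_row (mat_adjoint A) = dim_col A" "dim_col (mat_adjoint A) = dim_row A"
  unfolding mat_adjoint_def by auto

lemma index_mat_adjoint [simp]: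
  fixes A :: "complex mat"
  assumes "i < dim_col A" "j < dim_row A"
  shows "mat_adjoint A $$ (i, j) = cnj (A $$ (j, i))"
  using assms unfolding mat_adjoint_def by (simp add: mat_of_rows_index)

lemma mat_adjoint_adjoint [simp]:
  fixes A :: "complex mat"
  shows "mat_adjoint (mat_adjoint A) = A"
  by (rule eq_matI) auto

lemma mat_adjoint_mult:
  fixes A :: "complex mat"
  assumes "A \<in> carrier_mat n m" "B \<in> carrier_mat m k"
  shows "mat_adjoint (A * B) = mat_adjoint B * mat_adjoint A"
  by (rule eq_matI) (use assms in \<open>auto simp: scalar_prod_def intro!: sum.cong\<close>)

lemma mat_adjoint_minus:
  fixes A :: "complex mat"
  assumes "A \<in> carrier_mat n m" "B \<in> carrier_mat n m"
  shows "mat_adjoint (A - B) = mat_adjoint A - mat_adjoint B"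
  by (rule eq_matI) (use assms in auto)

lemma cscalar_prod_sum:
  fixes x y :: "complex vec"
  assumes "y \<in> carrier_vec n"
  shows "x \<bullet>c y = (\<Sum>i<n. x $ i * cnj (y $ i))"
  using assms by (auto simp: scalar_prod_def lessThan_atLeast0)

lemma mult_mat_vec_index_sum:
  fixes A :: "complex mat"
  assumes "A \<in> carrier_mat n m" "x \<in> carrier_vec m" "i < n"
  shows "(A *\<^sub>v x) $ i = (\<Sum>j<m. A $$ (i, j) * x $ j)"
  using assms by (auto simp: scalar_prod_def lessThan_atLeast0)

lemma mult_mat_index_sum:
  fixes A :: "complex mat"
  assumes "A \<in> carrier_mat n m" "B \<in> carrier_mat m k" "i < n" "j < k"
  shows "(A * B) $$ (i, j) = (\<Sum>l<m. A $$ (i, l) * B $$ (l, j))"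
  using assms by (auto simp: scalar_prod_def lessThan_atLeast0)

lemma cscalar_prod_adjoint:
  fixes A :: "complex mat"
  assumes A: "A \<in> carrier_mat n m" and x: "x \<in> carrier_vec m" and y: "y \<in> carrier_vec n"
  shows "(A *\<^sub>v x) \<bullet>c y = x \<bullet>c (mat_adjoint A *\<^sub>v y)"
proof -
  have "(A *\<^sub>v x) \<bullet>c y = (\<Sum>i<n. \<Sum>j<m. A $$ (i, j) * x $ j * cnj (y $ i))"
    using assms unfolding cscalar_prod_sum[OF y]
    by (auto simp: mult_mat_vec_index_sum[OF A x] sum_distrib_right simp del: index_mult_mat_vec
             intro!: sum.cong)
  also have "\<dots> = (\<Sum>j<m. \<Sum>i<n. A $$ (i, j) * x $ j * cnj (y $ i))"
    by (rule sum.swap)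
  also have "\<dots> = x \<bullet>c (mat_adjoint A *\<^sub>v y)"
    using assms
      cscalar_prod_sum[OF mult_mat_vec_carrier[OF mat_adjoint_carrier[OF A] y], of x]
    by (auto simp: mult_mat_vec_index_sum[OF mat_adjoint_carrier[OF A] y] sum_distrib_left 
             simp del: index_mult_mat_vec intro!: sum.cong)
  finally show ?thesis .
qed

lemma cscalar_prod_smult_right:
  fixes x y :: "complex vec"
  assumes "x \<in> carrier_vec n" "y \<in> carrier_vec n"
  shows "x \<bullet>c (a \<cdot>\<^sub>v y) = cnj a * (x \<bullet>c y)"
  using assms by (simp add: conjugate_smult_vec)

lemma cscalar_prod_self:
  fixes x :: "complex vec"
  assumes "x \<in> carrier_vec n"
  shows "x \<bullet>c x = complex_of_real (\<Sum>i<n. (cmod (x $ i))\<^sup>2)"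
  unfolding cscalar_prod_sum[OF assms] by (simp flip: complex_norm_square)

lemma mat_eq_if_mult_vec_eq:
  fixes A :: "complex mat"
  assumes "A \<in> carrier_mat n m" "B \<in> carrier_mat n m"
    and "\<And>x. x \<in> carrier_vec m \<Longrightarrow> A *\<^sub>v x = B *\<^sub>v x"
  shows "A = B"
proof (rule eq_matI)
  fix i j assume ij: "i < dim_row B" "j < dim_col B"
  then have "(A *\<^sub>v unit_vec m j) $ i = (B *\<^sub>v unit_vec m j) $ i" using assms by simp
  then show "A $$ (i, j) = B $$ (i, j)" using ij assms(1,2) by simp
qed (use assms in auto)

text \<open>Serves to deflate a Hermitian matrix by one eigenvector. Gram-Schmidt on a basis that
  starts with \<open>v\<close> keeps \<open>v\<close> in front and yields orthogonal, unnormalised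
  vectors; dividing each by its length gives the columns of \<open>W\<close>, so \<open>c\<close> is
  the reciprocal length of \<open>v\<close>.\<close>

lemma unitary_completion:
  fixes v :: "complex vec"
  assumes v: "v \<in> carrier_vec n" and v0: "v \<noteq> 0\<^sub>v n"
  shows "\<exists>W c. W \<in> carrier_mat n n \<and> mat_adjoint W * W = 1\<^sub>m n \<and> col W 0 = c \<cdot>\<^sub>v v"
proof -
  interpret cof_vec_space n "TYPE(complex)" .
  have n: "0 < n" using v v0 by (cases n) auto
  define ws where "ws = gram_schmidt n (basis_completion v)"
  note bc = basis_completion[OF v v0]
  note gs = gram_schmidt_result[OF bc(2,4,5) ws_def]
  have len: "length ws = n" using gs(4) bc(6) by simp
  have wsn: "basis_completion v = v # tl (basis_completion v)"
    using bc(6,7) n by (cases "basis_completion v") auto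
  have hd: "ws ! 0 = v"
    using gram_schmidt_hd[OF v, of "tl (basis_completion v)"] wsn len n
    unfolding ws_def by (metis hd_conv_nth length_greater_0_conv)
  have wsC: "ws ! i \<in> carrier_vec n" if "i < n" for i using gs(3) len that by auto
  define g where "g i = sqrt (\<Sum>k<n. (cmod (ws ! i $ k))\<^sup>2)" for i
  have nrm: "ws ! i \<bullet>c ws ! i = complex_of_real ((g i)\<^sup>2)" if "i < n" for i
    using cscalar_prod_self[OF wsC[OF that]] unfolding g_def by (simp add: sum_nonneg)
  \<comment> \<open>The equivalence carries two facts: distinct vectors are orthogonal, and no
    vector has length zero, which makes the division by \<open>g i\<close> legitimate.\<close>
  have orth: "ws ! i \<bullet>c ws ! j = 0 \<longleftrightarrow> i \<noteq> j" if "i < n" "j < n" for i j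
    using corthogonalD[OF gs(2)] len that by auto
  have g0: "g i \<noteq> 0" if "i < n" for i
    using orth[OF that that] nrm[OF that] by auto
  define W where "W = mat n n (\<lambda>(k, i). ws ! i $ k / complex_of_real (g i))"
  have W: "W \<in> carrier_mat n n" by (simp add: W_def)
  have "mat_adjoint W * W = 1\<^sub>m n"
  proof (rule eq_matI)
    fix i j assume "i < dim_row (1\<^sub>m n :: complex mat)" "j < dim_col (1\<^sub>m n :: complex mat)"
    then have ij: "i < n" "j < n" by auto
    have "(mat_adjoint W * W) $$ (i, j) 
      = (\<Sum>k<n. ws ! j $ k * cnj (ws ! i $ k)) / complex_of_real (g i * g j)"
      using mult_mat_index_sum[OF mat_adjoint_carrier[OF W] W ij] ij
      by (simp add: W_def sum_divide_distrib mult.commute)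
    also have "\<dots> = (ws ! j \<bullet>c ws ! i) / complex_of_real (g i * g j)"
      using cscalar_prod_sum[OF wsC[OF ij(1)]] by simp
    also have "\<dots> = (if i = j then 1 else 0)"
      using ij orth[OF ij(2,1)] nrm[OF ij(1)] g0 by (auto simp: power2_eq_square)
    finally show "(mat_adjoint W * W) $$ (i, j) = 1\<^sub>m n $$ (i, j)" using ij by simp
  qed (use W in auto)
  moreover have "col W 0 = (1 / complex_of_real (g 0)) \<cdot>\<^sub>v v"
    by (rule eq_vecI) (use n hd v in \<open>auto simp: W_def\<close>)
  ultimately show ?thesis using W by blast
qed

section \<open>Unitary matrices and orthonormal eigenbases\<close>

lemma unitary_right_inverse:
  fixes U :: "complex mat"
  assumes "U \<in> carrier_mat d d" "mat_adjoint U * U = 1\<^sub>m d"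
  shows "U * mat_adjoint U = 1\<^sub>m d"
  using mat_mult_left_right_inverse[OF mat_adjoint_carrier[OF assms(1)] assms(1,2)] .

lemma cscalar_prod_unitary:
  fixes U :: "complex mat"
  assumes U: "U \<in> carrier_mat d d" "mat_adjoint U * U = 1\<^sub>m d"
    and x: "x \<in> carrier_vec d" and y: "y \<in> carrier_vec d"
  shows "(U *\<^sub>v x) \<bullet>c (U *\<^sub>v y) = x \<bullet>c y"
proof -
  have "(U *\<^sub>v x) \<bullet>c (U *\<^sub>v y) = x \<bullet>c (mat_adjoint U *\<^sub>v (U *\<^sub>v y))"
    by (rule cscalar_prod_adjoint[OF U(1) x]) (use U y in auto)
  also have "mat_adjoint U *\<^sub>v (U *\<^sub>v y) = (mat_adjoint U * U) *\<^sub>v y"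
    by (rule assoc_mult_mat_vec[symmetric]) (use U y in auto)
  finally show ?thesis using U y by simp
qed

text \<open>Moving \<open>A\<close> to the other side of the inner product turns \<open>e\<close>
  into its conjugate, while the norm of \<open>x\<close> does not vanish.\<close>

lemma hermitian_eigenvalue_real:
  assumes A: "hermitian_mat d A" and x: "x \<in> carrier_vec d" "x \<noteq> 0\<^sub>v d"
    and e: "A *\<^sub>v x = e \<cdot>\<^sub>v x"
  shows "e \<in> \<real>"
proof -
  have Ac: "A \<in> carrier_mat d d" "mat_adjoint A = A" using A by (auto simp: hermitian_mat_def)
  have "e * (x \<bullet>c x) = cnj e * (x \<bullet>c x)"
    using cscalar_prod_adjoint[OF Ac(1) x(1) x(1)] x(1)
    by (simp add: Ac(2) e cscalar_prod_smult_right[OF x(1) x(1)])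
  moreover have "x \<bullet>c x \<noteq> 0" using x by simp
  ultimately have "cnj e = e" by simp
  then show ?thesis by (simp add: Reals_cnj_iff)
qed

text \<open>Induction on the dimension by deflation. A unitary \<open>W\<close> whose first column
  is an eigenvector turns \<open>A\<close> into a block matrix with a scalar corner and a smaller
  Hermitian block \<open>B\<close>. The eigenbasis of \<open>B\<close>, padded by a zero and joined
  by the first unit vector, is carried back by \<open>W\<close>.\<close>

lemma hermitian_eigenbasis:
  assumes "hermitian_mat d A"
  shows "\<exists>u (l :: nat \<Rightarrow> real). \<forall>i<d. u i \<in> carrier_vec d 
    \<and> A *\<^sub>v u i = complex_of_real (l i) \<cdot>\<^sub>v u i
    \<and> (\<forall>j<d. u i \<bullet>c u j = (if i = j then 1 else 0))"
  using assms
proof (induction d arbitrary: A)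
  case 0
  then show ?case by auto
next
  case (Suc d)
  let ?n = "Suc d"
  have A: "A \<in> carrier_mat ?n ?n" and Ah: "mat_adjoint A = A"
    using Suc.prems by (auto simp: hermitian_mat_def)
  \<comment> \<open>Algebraic closedness of the complex numbers supplies an eigenvalue, the
    dimension being positive here.\<close>
  obtain e v where v: "v \<in> carrier_vec ?n" "v \<noteq> 0\<^sub>v ?n" "A *\<^sub>v v = e \<cdot>\<^sub>v v"
    using spectrum_non_empty[OF A] A unfolding spectrum_def eigenvalue_def eigenvector_def by auto
  have er: "e \<in> \<real>" using hermitian_eigenvalue_real[OF Suc.prems v] .
  obtain W c where W: "W \<in> carrier_mat ?n ?n" "mat_adjoint W * W = 1\<^sub>m ?n" "col W 0 = c \<cdot>\<^sub>v v"
    using unitary_completion[OF v(1,2)] by auto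
  note W' = mat_adjoint_carrier[OF W(1)]
  have WW: "W * mat_adjoint W = 1\<^sub>m ?n" using unitary_right_inverse[OF W(1,2)] .
  define A' where "A' = mat_adjoint W * (A * W)"
  have A': "A' \<in> carrier_mat ?n ?n" using W A by (auto simp: A'_def)
  have A'h: "mat_adjoint A' = A'"
    unfolding A'_def
    using W A by (simp add: mat_adjoint_mult[OF W' mult_carrier_mat[OF A W(1)]] 
        mat_adjoint_mult[OF A W(1)] Ah assoc_mult_mat[OF W' A W(1)])
  have colW: "col (A * W) 0 = e \<cdot>\<^sub>v col W 0"
  proof -
    have "col (A * W) 0 = A *\<^sub>v (c \<cdot>\<^sub>v v)" using col_mult2[OF A W(1), of 0] W(3) by simp
    also have "\<dots> = c \<cdot>\<^sub>v (e \<cdot>\<^sub>v v)" using mult_mat_vec[OF A v(1), of c] v(3) by simp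
    also have "\<dots> = e \<cdot>\<^sub>v col W 0" by (simp add: W(3) smult_smult_assoc mult.commute)
    finally show ?thesis .
  qed
  have colc: "col W 0 \<in> carrier_vec ?n" using W(3) v(1) by simp
  have "col A' 0 = mat_adjoint W *\<^sub>v (e \<cdot>\<^sub>v col W 0)"
    using col_mult2[OF W' mult_carrier_mat[OF A W(1)], of 0] colW by (simp add: A'_def)
  also have "\<dots> = e \<cdot>\<^sub>v col (mat_adjoint W * W) 0"
    using mult_mat_vec[OF W' colc, of e] col_mult2[OF W' W(1), of 0] by simp
  finally have col0: "col A' 0 = e \<cdot>\<^sub>v unit_vec ?n 0" by (simp add: W(2))
  have c0: "A' $$ (i, 0) = (if i = 0 then e else 0)" if "i < ?n" for i
    using arg_cong[OF col0, of "\<lambda>w. w $ i"] that A' by (auto split: if_splits)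
  \<comment> \<open>Hermitian symmetry transfers the zeros below the corner to the first row; with
    them the matrix becomes block diagonal.\<close>
  have r0: "A' $$ (0, Suc i) = 0" if "i < d" for i
  proof -
    have "A' $$ (0, Suc i) = cnj (A' $$ (Suc i, 0))"
      using that A' by (subst A'h[symmetric]) simp
    then show ?thesis using c0[of "Suc i"] that by simp
  qed
  define B where "B = mat d d (\<lambda>(i, j). A' $$ (Suc i, Suc j))"
  have Bc: "B \<in> carrier_mat d d" by (simp add: B_def)
  have "mat_adjoint B = B"
  proof (rule eq_matI)
    fix i j assume "i < dim_row B" "j < dim_col B"
    then have ij: "i < d" "j < d" using Bc by auto
    have "cnj (A' $$ (Suc j, Suc i)) = A' $$ (Suc i, Suc j)"
      using ij A' by (subst (2) A'h[symmetric]) simp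
    then show "mat_adjoint B $$ (i, j) = B $$ (i, j)" using ij Bc by (simp add: B_def)
  qed (use Bc in auto)
  then have "hermitian_mat d B" using Bc by (simp add: hermitian_mat_def)
  from Suc.IH[OF this] obtain x l where xl: "\<And>i. i < d \<Longrightarrow> x i \<in> carrier_vec d"
    "\<And>i. i < d \<Longrightarrow> B *\<^sub>v x i = complex_of_real (l i) \<cdot>\<^sub>v x i"
    "\<And>i j. i < d \<Longrightarrow> j < d \<Longrightarrow> x i \<bullet>c x j = (if i = j then 1 else 0)" by blast
  \<comment> \<open>Index 0 holds the eigenvector that \<open>W\<close> splits off, index k + 1 the
    k-th eigenvector of \<open>B\<close>.\<close>
  define y where "y i = (case i of 0 \<Rightarrow> vCons 1 (0\<^sub>v d) | Suc k \<Rightarrow> vCons 0 (x k))" for i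
  define m where "m i = (case i of 0 \<Rightarrow> Re e | Suc k \<Rightarrow> l k)" for i
  have yc: "y i \<in> carrier_vec ?n" if "i < ?n" for i
    using that xl(1) by (auto simp: y_def split: nat.splits)
  have A'vc: "A' *\<^sub>v vCons a z = vCons (e * a) (B *\<^sub>v z)" if "z \<in> carrier_vec d" for a z
  proof (rule eq_vecI)
    fix i assume i: "i < dim_vec (vCons (e * a) (B *\<^sub>v z))"
    then have i: "i < ?n" using Bc by simp
    have zc: "vCons a z \<in> carrier_vec ?n" using that by simp
    have "(A' *\<^sub>v vCons a z) $ i = A' $$ (i, 0) * a + (\<Sum>j<d. A' $$ (i, Suc j) * z $ j)"
      using that unfolding mult_mat_vec_index_sum[OF A' zc i] 
      by (subst sum.lessThan_Suc_shift) (auto intro!: sum.cong)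
    also have "\<dots> = vCons (e * a) (B *\<^sub>v z) $ i"
    proof (cases i)
      case 0
      then show ?thesis using c0[of 0] r0 by simp
    next
      case (Suc k)
      then have "(B *\<^sub>v z) $ k = (\<Sum>j<d. A' $$ (i, Suc j) * z $ j)"
        using i mult_mat_vec_index_sum[OF Bc that, of k] by (simp add: B_def)
      then show ?thesis using Suc c0[OF i] i Bc by simp
    qed
    finally show "(A' *\<^sub>v vCons a z) $ i = vCons (e * a) (B *\<^sub>v z) $ i" .
  qed (use A' Bc in auto)
  have eR: "complex_of_real (Re e) = e" using er by simp
  have A'y: "A' *\<^sub>v y i = complex_of_real (m i) \<cdot>\<^sub>v y i" if "i < ?n" for i
  proof (cases i)
    case 0
    have "B *\<^sub>v 0\<^sub>v d = 0\<^sub>v d"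
      by (rule eq_vecI) (use Bc in \<open>auto simp: scalar_prod_def\<close>)
    then have "A' *\<^sub>v vCons 1 (0\<^sub>v d) = vCons e (0\<^sub>v d)" using A'vc[of "0\<^sub>v d" 1] by simp
    also have "\<dots> = e \<cdot>\<^sub>v vCons 1 (0\<^sub>v d)"
      by (rule eq_vecI) (auto simp: vec_index_vCons)
    finally show ?thesis using 0 eR by (simp add: y_def m_def)
  next
    case (Suc k)
    then have k: "k < d" using that by simp
    have "A' *\<^sub>v vCons 0 (x k) = vCons 0 (complex_of_real (l k) \<cdot>\<^sub>v x k)"
      using A'vc[OF xl(1)[OF k], of 0] xl(2)[OF k] by simp
    also have "\<dots> = complex_of_real (l k) \<cdot>\<^sub>v vCons 0 (x k)"
      by (rule eq_vecI) (auto simp: vec_index_vCons)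
    finally show ?thesis using Suc by (simp add: y_def m_def)
  qed
  have yo: "y i \<bullet>c y j = (if i = j then 1 else 0)" if "i < ?n" "j < ?n" for i j
    using that xl(1,3) by (auto simp: y_def split: nat.splits)
  \<comment> \<open>In this intertwining form, \<open>W\<close> maps eigenvectors of
    \<open>A'\<close> to eigenvectors of \<open>A\<close> with the same eigenvalue.\<close>
  have WA': "W * A' = A * W"
    using W(1) W' A unfolding A'_def
    by (simp add: assoc_mult_mat[OF W(1) W' mult_carrier_mat[OF A W(1)], symmetric] WW)
  show ?case
  proof (intro exI allI impI conjI)
    fix i assume i: "i < ?n"
    show "W *\<^sub>v y i \<in> carrier_vec ?n" using W(1) yc[OF i] by auto
    have "A *\<^sub>v (W *\<^sub>v y i) = W *\<^sub>v (A' *\<^sub>v y i)"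
      using assoc_mult_mat_vec[OF A W(1) yc[OF i]] assoc_mult_mat_vec[OF W(1) A' yc[OF i]] WA'
      by simp
    also have "\<dots> = complex_of_real (m i) \<cdot>\<^sub>v (W *\<^sub>v y i)"
      using A'y[OF i] mult_mat_vec[OF W(1) yc[OF i]] by simp
    finally show "A *\<^sub>v (W *\<^sub>v y i) = complex_of_real (m i) \<cdot>\<^sub>v (W *\<^sub>v y i)" .
    fix j assume j: "j < ?n"
    show "(W *\<^sub>v y i) \<bullet>c (W *\<^sub>v y j) = (if i = j then 1 else 0)"
      using cscalar_prod_unitary[OF W(1,2) yc[OF i] yc[OF j]] yo[OF i j] by simp
  qed
qed

section \<open>Functions of a diagonalised matrix\<close>

text \<open>The functional calculus of a diagonalised matrix. The function is indexed by the columns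
  of \<open>U\<close> and not by eigenvalues: if \<open>l\<close> gives a matrix A, then
  \<open>\<lambda>k. p (l k)\<close> gives p(A). Real values make every such matrix
  Hermitian.\<close>

definition unitary_conj :: "nat \<Rightarrow> complex mat \<Rightarrow> (nat \<Rightarrow> real) \<Rightarrow> complex mat" where
  "unitary_conj d U f = U * mat_diag d (\<lambda>i. complex_of_real (f i)) * mat_adjoint U"

locale unitary =
  fixes d :: nat and U :: "complex mat"
  assumes U_carrier: "U \<in> carrier_mat d d"
    and adjoint_mult_U: "mat_adjoint U * U = 1\<^sub>m d"
begin

abbreviation F :: "(nat \<Rightarrow> real) \<Rightarrow> complex mat" where
  "F \<equiv> unitary_conj d U"

lemma U_adjoint_carrier: "mat_adjoint U \<in> carrier_mat d d"
  using U_carrier by simp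

lemma mult_U_adjoint: "U * mat_adjoint U = 1\<^sub>m d"
  using unitary_right_inverse[OF U_carrier adjoint_mult_U] .

lemma col_U_carrier: "k < d \<Longrightarrow> col U k \<in> carrier_vec d"
  using U_carrier by (simp add: carrier_vecI)

lemma adjoint_mult_col_U: "k < d \<Longrightarrow> mat_adjoint U *\<^sub>v col U k = unit_vec d k"
  using col_mult2[OF U_adjoint_carrier U_carrier] adjoint_mult_U by simp

lemma adjoint_mult_U_vec: "x \<in> carrier_vec d \<Longrightarrow> mat_adjoint U *\<^sub>v (U *\<^sub>v x) = x"
  using assoc_mult_mat_vec[OF U_adjoint_carrier U_carrier] adjoint_mult_U by simp

lemma mult_U_adjoint_vec: "x \<in> carrier_vec d \<Longrightarrow> U *\<^sub>v (mat_adjoint U *\<^sub>v x) = x"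
  using assoc_mult_mat_vec[OF U_carrier U_adjoint_carrier] mult_U_adjoint by simp

lemma adjoint_mult_vec_carrier: "x \<in> carrier_vec d \<Longrightarrow> mat_adjoint U *\<^sub>v x \<in> carrier_vec d"
  using U_adjoint_carrier by simp

lemma F_carrier [simp]: "F f \<in> carrier_mat d d"
  using U_carrier by (auto simp: unitary_conj_def)

lemma dim_F [simp]: "dim_row (F f) = d" "dim_col (F f) = d"
  using carrier_matD[OF F_carrier[of f]] by auto

text \<open>Entries are linear in \<open>f\<close>, so the additive rules below can be checked
  entrywise. Products are not visible on entries and go through the action on vectors
  instead.\<close>

lemma [simp]:
  assumes "i < d" "j < d"
  shows "F f $$ (i, j) = (\<Sum>k<d. complex_of_real (f k) * U $$ (i, k) * cnj (U $$ (j, k)))"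
proof -
  let ?D = "mat_diag d (\<lambda>i. complex_of_real (f i))"
  have "F f $$ (i, j) = (\<Sum>k<d. (U * ?D) $$ (i, k) * mat_adjoint U $$ (k, j))"
    unfolding unitary_conj_def
    by (rule mult_mat_index_sum[OF mult_carrier_mat[OF U_carrier mat_diag_dim]
          U_adjoint_carrier assms])
  also have "\<dots> = (\<Sum>k<d. complex_of_real (f k) * U $$ (i, k) * cnj (U $$ (j, k)))"
    using U_carrier assms by (auto simp: mat_diag_mult_right[OF U_carrier] intro!: sum.cong)
  finally show ?thesis .
qed

lemma F_cong: "(\<And>k. k < d \<Longrightarrow> f k = g k) \<Longrightarrow> F f = F g"
  by (rule eq_matI) auto

lemma F_add: "F f + F g = F (\<lambda>k. f k + g k)"
  by (rule eq_matI) (auto simp: distrib_right sum.distrib)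

lemma F_smult: "complex_of_real c \<cdot>\<^sub>m F f = F (\<lambda>k. c * f k)"
  by (rule eq_matI) (auto simp: sum_distrib_left mult.assoc)

lemma F_uminus: "- F f = F (\<lambda>k. - f k)"
  by (rule eq_matI) (auto simp: sum_negf)

lemma F_zero: "F (\<lambda>k. 0) = 0\<^sub>m d d"
  by (rule eq_matI) auto

lemma F_one: "F (\<lambda>k. 1) = 1\<^sub>m d"
  using U_carrier mult_U_adjoint by (simp add: unitary_conj_def)

lemma F_mult_vec:
  assumes "x \<in> carrier_vec d"
  shows "F f *\<^sub>v x = U *\<^sub>v vec d (\<lambda>k. complex_of_real (f k) * (mat_adjoint U *\<^sub>v x) $ k)"
proof -
  let ?D = "mat_diag d (\<lambda>i. complex_of_real (f i))"
  have "?D *\<^sub>v y = vec d (\<lambda>k. complex_of_real (f k) * y $ k)" if "y \<in> carrier_vec d" for y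
  proof (rule eq_vecI)
    fix i assume "i < dim_vec (vec d (\<lambda>k. complex_of_real (f k) * y $ k))"
    then have i: "i < d" by simp
    have "(?D *\<^sub>v y) $ i = (\<Sum>j<d. if i = j then complex_of_real (f j) * y $ j else 0)"
      unfolding mult_mat_vec_index_sum[OF mat_diag_dim that i]
      by (rule sum.cong) (use i in \<open>auto simp: mat_diag_def\<close>)
    then show "(?D *\<^sub>v y) $ i = vec d (\<lambda>k. complex_of_real (f k) * y $ k) $ i"
      using i by simp
  qed (simp add: mat_diag_def)
  note D = this[OF adjoint_mult_vec_carrier[OF assms]]
  have "F f *\<^sub>v x = U * ?D *\<^sub>v (mat_adjoint U *\<^sub>v x)"
    unfolding unitary_conj_def
    by (rule assoc_mult_mat_vec[OF mult_carrier_mat[OF U_carrier mat_diag_dim]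
          U_adjoint_carrier assms])
  also have "\<dots> = U *\<^sub>v (?D *\<^sub>v (mat_adjoint U *\<^sub>v x))"
    by (rule assoc_mult_mat_vec[OF U_carrier mat_diag_dim adjoint_mult_vec_carrier[OF assms]])
  finally show ?thesis unfolding D .
qed

lemma adjoint_mult_F_mult_vec:
  assumes "x \<in> carrier_vec d"
  shows "mat_adjoint U *\<^sub>v (F f *\<^sub>v x)
    = vec d (\<lambda>k. complex_of_real (f k) * (mat_adjoint U *\<^sub>v x) $ k)"
  unfolding F_mult_vec[OF assms] by (rule adjoint_mult_U_vec) simp

lemma mult_U_unit_vec: "k < d \<Longrightarrow> U *\<^sub>v unit_vec d k = col U k"
  using mult_U_adjoint_vec[OF col_U_carrier] adjoint_mult_col_U by simp

lemma F_mult_col_U: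
  assumes "k < d"
  shows "F f *\<^sub>v col U k = complex_of_real (f k) \<cdot>\<^sub>v col U k"
proof -
  have "F f *\<^sub>v col U k = U *\<^sub>v (complex_of_real (f k) \<cdot>\<^sub>v unit_vec d k)"
    unfolding F_mult_vec[OF col_U_carrier[OF assms]] adjoint_mult_col_U[OF assms]
    by (rule arg_cong[where f = "\<lambda>x. U *\<^sub>v x"], rule eq_vecI) (use assms in auto)
  also have "\<dots> = complex_of_real (f k) \<cdot>\<^sub>v col U k"
    using mult_mat_vec[OF U_carrier unit_vec_carrier] mult_U_unit_vec[OF assms] by simp
  finally show ?thesis .
qed

text \<open>Between the two factors \<open>mat_adjoint U\<close> cancels against \<open>U\<close>,
  leaving two successive rescalings of the same coordinates.\<close>

lemma F_mult: "F f * F g = F (\<lambda>k. f k * g k)"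
proof (rule mat_eq_if_mult_vec_eq)
  fix x :: "complex vec" assume x: "x \<in> carrier_vec d"
  have "F f * F g *\<^sub>v x = F f *\<^sub>v (F g *\<^sub>v x)"
    by (rule assoc_mult_mat_vec[OF F_carrier F_carrier x])
  also have "\<dots> = U *\<^sub>v vec d (\<lambda>k. complex_of_real (f k) 
      * vec d (\<lambda>k. complex_of_real (g k) * (mat_adjoint U *\<^sub>v x) $ k) $ k)"
    using F_mult_vec[OF mult_mat_vec_carrier[OF F_carrier x], of f g]
      adjoint_mult_F_mult_vec[OF x, of g] by simp
  also have "\<dots> = F (\<lambda>k. f k * g k) *\<^sub>v x"
    unfolding F_mult_vec[OF x]
    by (rule arg_cong[where f = "\<lambda>x. U *\<^sub>v x"], rule eq_vecI) auto
  finally show "F f * F g *\<^sub>v x = F (\<lambda>k. f k * g k) *\<^sub>v x" .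
qed (auto intro: mult_carrier_mat)

lemma hermitian_F: "hermitian_mat d (F f)"
proof -
  have "mat_adjoint (F f) = F f"
  proof (rule eq_matI)
    fix i j assume "i < dim_row (F f)" "j < dim_col (F f)"
    then have ij: "i < d" "j < d" using F_carrier[of f] by auto
    show "mat_adjoint (F f) $$ (i, j) = F f $$ (i, j)"
      using ij by (auto simp: mult.commute mult.left_commute)
  qed auto
  then show ?thesis by (simp add: hermitian_mat_def)
qed

lemma F_quadratic_form:
  assumes x: "x \<in> carrier_vec d"
  shows "(F f *\<^sub>v x) \<bullet>c x
    = complex_of_real (\<Sum>k<d. f k * (cmod ((mat_adjoint U *\<^sub>v x) $ k))\<^sup>2)"
proof -
  have "(F f *\<^sub>v x) \<bullet>c x
    = vec d (\<lambda>k. complex_of_real (f k) * (mat_adjoint U *\<^sub>v x) $ k) \<bullet>c (mat_adjoint U *\<^sub>v x)"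
    unfolding F_mult_vec[OF x] by (rule cscalar_prod_adjoint[OF U_carrier _ x]) simp
  then show ?thesis
    unfolding cscalar_prod_sum[OF adjoint_mult_vec_carrier[OF x]]
    by (simp add: mult.assoc flip: complex_norm_square del: index_mult_mat_vec)
qed

lemma psd_F:
  assumes "\<And>k. k < d \<Longrightarrow> 0 \<le> f k"
  shows "psd_mat d (F f)"
  unfolding psd_mat_def
  using assms by (auto simp: hermitian_F F_quadratic_form intro!: sum_nonneg simp del: index_mult_mat_vec)

lemma col_U_norm: "k < d \<Longrightarrow> col U k \<bullet>c col U k = 1"
  using cscalar_prod_adjoint[OF U_carrier unit_vec_carrier col_U_carrier, of k k]
    adjoint_mult_col_U[of k] mult_U_unit_vec[of k] by simp

text \<open>Each column of \<open>U\<close> is a unit eigenvector, so the quadratic form at column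
  \<open>k\<close> is exactly \<open>f k\<close>. This is the converse of
  \<open>psd_F\<close>.\<close>

lemma F_nonneg:
  assumes "psd_mat d (F f)" "k < d"
  shows "0 \<le> f k"
  using assms col_U_carrier[OF assms(2)] col_U_norm[OF assms(2)] F_mult_col_U[OF assms(2), of f]
  unfolding psd_mat_def by fastforce

text \<open>\<open>F f\<close> is the sum of the rank-one projectors onto the columns of
  \<open>U\<close>, weighted by \<open>f\<close>, and the trace of such a projector times
  \<open>B\<close> is the quadratic form of \<open>B\<close> at that column. In entries this is only
  a reordering of a triple sum.\<close>

lemma trace_F_mult:
  assumes B: "B \<in> carrier_mat d d"
  shows "mat_trace (F f * B) = (\<Sum>k<d. complex_of_real (f k) * ((B *\<^sub>v col U k) \<bullet>c col U k))"
proof -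
  have "mat_trace (F f * B) = (\<Sum>i<d. (F f * B) $$ (i, i))"
    using F_carrier[of f] unfolding mat_trace_def by (metis carrier_matD(1) index_mult_mat(2))
  also have "\<dots> = (\<Sum>i<d. \<Sum>j<d. \<Sum>k<d. 
      complex_of_real (f k) * (B $$ (j, i) * U $$ (i, k)) * cnj (U $$ (j, k)))"
    by (intro sum.cong refl)
      (auto simp: mult_mat_index_sum[OF F_carrier B] sum_distrib_right sum_distrib_left ac_simps
        intro!: sum.cong)
  also have "\<dots> = (\<Sum>i<d. \<Sum>k<d. \<Sum>j<d. 
      complex_of_real (f k) * (B $$ (j, i) * U $$ (i, k)) * cnj (U $$ (j, k)))"
    by (rule sum.cong[OF refl], rule sum.swap)
  also have "\<dots> = (\<Sum>k<d. \<Sum>i<d. \<Sum>j<d. 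
      complex_of_real (f k) * (B $$ (j, i) * U $$ (i, k)) * cnj (U $$ (j, k)))"
    by (rule sum.swap)
  also have "\<dots> = (\<Sum>k<d. complex_of_real (f k) * ((B *\<^sub>v col U k) \<bullet>c col U k))"
  proof (rule sum.cong[OF refl])
    fix k assume "k \<in> {..<d}"
    then have k: "k < d" by simp
    have "(B *\<^sub>v col U k) \<bullet>c col U k = (\<Sum>j<d. \<Sum>i<d. B $$ (j, i) * U $$ (i, k) * cnj (U $$ (j, k)))"
      unfolding cscalar_prod_sum[OF col_U_carrier[OF k]]
      using U_carrier k
      by (auto simp: mult_mat_vec_index_sum[OF B col_U_carrier[OF k]] sum_distrib_right
          simp del: index_mult_mat_vec intro!: sum.cong)
    also have "\<dots> = (\<Sum>i<d. \<Sum>j<d. B $$ (j, i) * U $$ (i, k) * cnj (U $$ (j, k)))"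
      by (rule sum.swap)
    finally show "(\<Sum>i<d. \<Sum>j<d. complex_of_real (f k) * (B $$ (j, i) * U $$ (i, k)) * cnj (U $$ (j, k)))
      = complex_of_real (f k) * ((B *\<^sub>v col U k) \<bullet>c col U k)"
      by (simp add: sum_distrib_left mult.assoc)
  qed
  finally show ?thesis .
qed

end

text \<open>The eigenbasis forms the columns of \<open>U\<close>. Both \<open>A\<close> and
  \<open>F l\<close> scale each column by its eigenvalue, so they agree after multiplication by
  \<open>U\<close>, which is invertible.\<close>

lemma hermitian_diagonalization:
  assumes "hermitian_mat d A"
  shows "\<exists>U l. unitary d U \<and> A = unitary_conj d U l"
proof -
  have A: "A \<in> carrier_mat d d" using assms by (simp add: hermitian_mat_def)
  obtain u l where ul: "\<And>i. i < d \<Longrightarrow> u i \<in> carrier_vec d"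
    "\<And>i. i < d \<Longrightarrow> A *\<^sub>v u i = complex_of_real (l i) \<cdot>\<^sub>v u i"
    "\<And>i j. i < d \<Longrightarrow> j < d \<Longrightarrow> u i \<bullet>c u j = (if i = j then 1 else 0)"
    using hermitian_eigenbasis[OF assms] by blast
  define U where "U = mat d d (\<lambda>(i, j). u j $ i)"
  have U: "U \<in> carrier_mat d d" by (simp add: U_def)
  have col: "col U k = u k" if "k < d" for k
    using ul(1)[OF that] that by (auto simp: U_def intro!: eq_vecI)
  have "mat_adjoint U * U = 1\<^sub>m d"
  proof (rule eq_matI)
    fix i j assume "i < dim_row (1\<^sub>m d :: complex mat)" "j < dim_col (1\<^sub>m d :: complex mat)"
    then have ij: "i < d" "j < d" by auto
    have "(mat_adjoint U * U) $$ (i, j) = u j \<bullet>c u i"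
      using ij unfolding mult_mat_index_sum[OF mat_adjoint_carrier[OF U] U ij]
        cscalar_prod_sum[OF ul(1)[OF ij(1)]]
      by (auto simp: U_def mult.commute intro!: sum.cong)
    then show "(mat_adjoint U * U) $$ (i, j) = 1\<^sub>m d $$ (i, j)" using ij ul(3) by simp
  qed (use U in auto)
  then interpret unitary d U using U by unfold_locales
  have "A * U = F l * U"
  proof (rule eq_matI)
    fix i k assume "i < dim_row (F l * U)" "k < dim_col (F l * U)"
    then have ik: "i < d" "k < d" using U F_carrier[of l] by auto
    have "col (A * U) k = col (F l * U) k"
      using ik F_mult_col_U[OF ik(2), of l] ul(2)[OF ik(2)] col[OF ik(2)]
      by (simp add: col_mult2[OF A U] col_mult2[OF F_carrier U])
    then have "col (A * U) k $ i = col (F l * U) k $ i" by simp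
    then show "(A * U) $$ (i, k) = (F l * U) $$ (i, k)"
      using ik A U F_carrier[of l] by (simp del: col_mult2)
  qed (use A U F_carrier[of l] in auto)
  then have "A * U * mat_adjoint U = F l * U * mat_adjoint U" by simp
  then have "A = F l"
    using A by (simp add: assoc_mult_mat[OF A U U_adjoint_carrier]
        assoc_mult_mat[OF F_carrier U U_adjoint_carrier] mult_U_adjoint
        right_mult_one_mat[OF F_carrier])
  then show ?thesis using unitary_axioms by blast
qed

text \<open>In an eigenbasis of \<open>A\<close> the trace is a sum of products of an eigenvalue of
  \<open>A\<close> and a value of the quadratic form of \<open>B\<close>, both nonnegative.\<close>

lemma trace_mult_psd_nonneg:
  assumes A: "psd_mat d A" and B: "psd_mat d B"
  shows "0 \<le> Re (mat_trace (A * B))"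
proof -
  obtain U l where U: "unitary d U" and Al: "A = unitary_conj d U l"
    using hermitian_diagonalization A unfolding psd_mat_def by blast
  interpret unitary d U by (rule U)
  have Bc: "B \<in> carrier_mat d d" using B by (simp add: psd_mat_def hermitian_mat_def)
  have "0 \<le> Re ((B *\<^sub>v col U k) \<bullet>c col U k)" if "k < d" for k
    using B col_U_carrier[OF that] by (simp add: psd_mat_def)
  moreover have "0 \<le> l k" if "k < d" for k
    using F_nonneg[of l k] A Al that by simp
  ultimately show ?thesis
    unfolding Al trace_F_mult[OF Bc] by (auto intro!: sum_nonneg)
qed

section \<open>Projectors and absolute value\<close>

text \<open>An idempotent fixes its range, so two candidates \<open>P\<close> and \<open>Q\<close>
  with equal range satisfy \<open>P * Q = Q\<close> and \<open>Q * P = P\<close>. Taking the adjoint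
  of the first equation yields \<open>Q = Q * P = P\<close>.\<close>

lemma orth_projector_eqI:
  assumes P: "hermitian_mat d P" "P * P = P" "(\<lambda>v. P *\<^sub>v v) ` carrier_vec d = S"
  shows "orth_projector d S = P"
proof -
  have absorb: "Q * R = R"
    if Q: "hermitian_mat d Q" "Q * Q = Q" "(\<lambda>v. Q *\<^sub>v v) ` carrier_vec d = S"
      and R: "hermitian_mat d R" "(\<lambda>v. R *\<^sub>v v) ` carrier_vec d = S" for Q R
  proof (rule mat_eq_if_mult_vec_eq)
    have Qc: "Q \<in> carrier_mat d d" and Rc: "R \<in> carrier_mat d d"
      using Q R by (auto simp: hermitian_mat_def)
    then show "Q * R \<in> carrier_mat d d" "R \<in> carrier_mat d d" by auto
    fix x :: "complex vec" assume x: "x \<in> carrier_vec d"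
    then have "R *\<^sub>v x \<in> (\<lambda>v. Q *\<^sub>v v) ` carrier_vec d" using Q(3) R(2) by auto
    then obtain y where y: "y \<in> carrier_vec d" "R *\<^sub>v x = Q *\<^sub>v y" by auto
    have "Q * R *\<^sub>v x = Q *\<^sub>v (Q *\<^sub>v y)"
      using assoc_mult_mat_vec[OF Qc Rc x] y by simp
    also have "\<dots> = R *\<^sub>v x"
      using assoc_mult_mat_vec[OF Qc Qc y(1)] Q(2) y(2) by simp
    finally show "Q * R *\<^sub>v x = R *\<^sub>v x" .
  qed
  show ?thesis
    unfolding orth_projector_def
  proof (rule the_equality)
    fix Q assume Q: "hermitian_mat d Q \<and> Q * Q = Q \<and> (\<lambda>v. Q *\<^sub>v v) ` carrier_vec d = S"
    have c: "P \<in> carrier_mat d d" "mat_adjoint P = P" "Q \<in> carrier_mat d d" "mat_adjoint Q = Q"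
      using P Q by (auto simp: hermitian_mat_def)
    have "Q = mat_adjoint (P * Q)" using absorb[of P Q] P Q c by simp
    also have "\<dots> = Q * P" using c by (simp add: mat_adjoint_mult[OF c(1,3)])
    also have "\<dots> = P" using absorb[of Q P] P Q by simp
    finally show "Q = P" .
  qed (use P in auto)
qed

text \<open>An eigenvector \<open>x\<close> of \<open>B - C\<close> with eigenvalue \<open>c\<close> satisfies
  \<open>0 = \<langle>(B\<^sup>2 - C\<^sup>2)x, x\<rangle> = c(\<langle>Bx, x\<rangle> + \<langle>Cx, x\<rangle>)\<close>, as \<open>B\<^sup>2 - C\<^sup>2 = B(B - C) + (B - C)C\<close>.\<close>
lemma psd_sqrt_unique:
  assumes B: "psd_mat d B" and C: "psd_mat d C" and eq: "B * B = C * C"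
  shows "B = C"
proof -
  have Bc: "B \<in> carrier_mat d d" "mat_adjoint B = B" and Cc: "C \<in> carrier_mat d d" "mat_adjoint C = C"
    using B C by (auto simp: psd_mat_def hermitian_mat_def)
  have "hermitian_mat d (B - C)"
    using Bc Cc by (simp add: hermitian_mat_def mat_adjoint_minus[OF Bc(1) Cc(1)]
        minus_carrier_mat)
  then obtain U l where U: "unitary d U" and BC: "B - C = unitary_conj d U l"
    using hermitian_diagonalization by blast
  interpret unitary d U by (rule U)
  have l0: "l k = 0" if k: "k < d" for k
  proof -
    let ?x = "col U k"
    note xc = col_U_carrier[OF k]
    have Bxc: "B *\<^sub>v ?x \<in> carrier_vec d" and Cxc: "C *\<^sub>v ?x \<in> carrier_vec d"
      using Bc Cc xc by auto
    let ?b = "(B *\<^sub>v ?x) \<bullet>c ?x" and ?c = "(C *\<^sub>v ?x) \<bullet>c ?x"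
    have "y = z + (y - z)" if "y \<in> carrier_vec d" "z \<in> carrier_vec d" for y z :: "complex vec"
      using that by (intro eq_vecI) auto
    from this[OF Bxc Cxc]
    have e: "B *\<^sub>v ?x = C *\<^sub>v ?x + complex_of_real (l k) \<cdot>\<^sub>v ?x"
      using F_mult_col_U[OF k, of l] minus_mult_distrib_mat_vec[OF Bc(1) Cc(1) xc]
      unfolding BC[symmetric] by simp
    have bc: "?b = ?c + complex_of_real (l k)"
      unfolding e using Cxc xc col_U_norm[OF k] 
      by (simp add: add_scalar_prod_distrib[of _ d])
    have "(B * B *\<^sub>v ?x) \<bullet>c ?x = (B *\<^sub>v ?x) \<bullet>c (B *\<^sub>v ?x)"
      using cscalar_prod_adjoint[OF Bc(1) Bxc xc] Bc assoc_mult_mat_vec[OF Bc(1) Bc(1) xc] by simp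
    also have "\<dots> = (B *\<^sub>v ?x) \<bullet>c (C *\<^sub>v ?x) + complex_of_real (l k) * ?b"
      by (subst (2) e)
        (use Bxc Cxc xc in \<open>simp add: conjugate_add_vec[of _ d] scalar_prod_add_distrib[of _ d]
          conjugate_smult_vec\<close>)
    also have "(B *\<^sub>v ?x) \<bullet>c (C *\<^sub>v ?x)
      = (C *\<^sub>v ?x) \<bullet>c (C *\<^sub>v ?x) + complex_of_real (l k) * (?x \<bullet>c (C *\<^sub>v ?x))"
      unfolding e using Cxc xc by (simp add: add_scalar_prod_distrib[of _ d])
    also have "?x \<bullet>c (C *\<^sub>v ?x) = ?c"
      using cscalar_prod_adjoint[OF Cc(1) xc xc] Cc by simp
    also have "(C *\<^sub>v ?x) \<bullet>c (C *\<^sub>v ?x) = (C * C *\<^sub>v ?x) \<bullet>c ?x"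
      using cscalar_prod_adjoint[OF Cc(1) Cxc xc] Cc assoc_mult_mat_vec[OF Cc(1) Cc(1) xc] by simp
    finally have "complex_of_real (l k) * (?b + ?c) = 0"
      unfolding eq by (simp add: algebra_simps)
    then have "l k = 0 \<or> ?b + ?c = 0" by auto
    moreover have "l k = 0" if "?b + ?c = 0"
    \<comment> \<open>Both forms are nonnegative, so a vanishing sum makes both real parts vanish;
      they differ by \<open>l k\<close>.\<close>
    proof -
      have "0 \<le> Re ?b" "0 \<le> Re ?c" "Re ?b + Re ?c = 0"
        using B C xc arg_cong[OF that, of Re] by (auto simp: psd_mat_def)
      then show ?thesis using arg_cong[OF bc, of Re] by simp
    qed
    ultimately show ?thesis by blast
  qed
  have D0: "B - C = 0\<^sub>m d d" unfolding BC using F_cong[of l "\<lambda>k. 0"] l0 F_zero by simp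
  show ?thesis
  proof (rule eq_matI)
    fix i j assume "i < dim_row C" "j < dim_col C"
    then show "B $$ (i, j) = C $$ (i, j)"
      using arg_cong[OF D0, of "\<lambda>X. X $$ (i, j)"] Bc Cc by simp
  qed (use Bc Cc in auto)
qed

section \<open>Spectral form of the two projectors and of the absolute value\<close>

context unitary
begin

text \<open>An eigenvector for \<open>r\<close> has nonzero coordinates only where
  \<open>l k = r\<close>, and there the indicator equals 1. Both projectors are shown to fix the
  required vectors in this way.\<close>

lemma F_indicator_mult_vec:
  assumes x: "x \<in> carrier_vec d" and Fx: "F l *\<^sub>v x = complex_of_real r \<cdot>\<^sub>v x" and "p r"
  shows "F (\<lambda>k. if p (l k) then 1 else 0) *\<^sub>v x = x"
proof -
  let ?w = "mat_adjoint U *\<^sub>v x"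
  have wc: "?w \<in> carrier_vec d" using adjoint_mult_vec_carrier[OF x] .
  have eig: "complex_of_real (l k) * ?w $ k = complex_of_real r * ?w $ k" if "k < d" for k
    using arg_cong[OF adjoint_mult_F_mult_vec[OF x, of l], of "\<lambda>w. w $ k"] that wc U_carrier
    by (auto simp: Fx mult_mat_vec[OF U_adjoint_carrier x] simp del: index_mult_mat_vec)
  have "F (\<lambda>k. if p (l k) then 1 else 0) *\<^sub>v x = U *\<^sub>v ?w"
    unfolding F_mult_vec[OF x]
  proof (rule arg_cong[where f = "\<lambda>w. U *\<^sub>v w"], rule eq_vecI)
    fix k assume "k < dim_vec ?w"
    then have k: "k < d" using U_carrier by simp
    then show "vec d (\<lambda>k. complex_of_real (if p (l k) then 1 else 0) * ?w $ k) $ k = ?w $ k"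
      using eig[OF k] \<open>p r\<close> by (cases "l k = r") (auto simp del: index_mult_mat_vec)
  qed (use U_carrier in auto)
  then show ?thesis using mult_U_adjoint_vec[OF x] by simp
qed

lemma null_projector_F: "null_projector d (F l) = F (\<lambda>k. if l k = 0 then 1 else 0)"
  unfolding null_projector_def
proof (rule orth_projector_eqI)
  let ?P = "F (\<lambda>k. if l k = 0 then 1 else 0)"
  show "hermitian_mat d ?P" by (rule hermitian_F)
  show "?P * ?P = ?P" unfolding F_mult by (rule F_cong) auto
  show "(\<lambda>v. ?P *\<^sub>v v) ` carrier_vec d = mat_kernel (F l)"
    unfolding mat_kernel[OF F_carrier]
  proof (intro subset_antisym subsetI)
    fix y assume "y \<in> (\<lambda>v. ?P *\<^sub>v v) ` carrier_vec d"
    then obtain x where x: "x \<in> carrier_vec d" "y = ?P *\<^sub>v x" by auto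
    \<comment> \<open>At every index either \<open>l k\<close> or the indicator is zero, so
      \<open>F l\<close> annihilates the range of the projector.\<close>
    have "F l * ?P = 0\<^sub>m d d"
      unfolding F_mult F_zero[symmetric] by (rule F_cong) auto
    moreover have "0\<^sub>m d d *\<^sub>v x = 0\<^sub>v d" using x(1) by (intro eq_vecI) auto
    ultimately have "F l *\<^sub>v y = 0\<^sub>v d"
      using assoc_mult_mat_vec[OF F_carrier F_carrier x(1), of l "\<lambda>k. if l k = 0 then 1 else 0"] x
      by simp
    then show "y \<in> {v. v \<in> carrier_vec d \<and> F l *\<^sub>v v = 0\<^sub>v d}"
      using x mult_mat_vec_carrier[OF F_carrier x(1)] by simp
  next
    fix y assume "y \<in> {v. v \<in> carrier_vec d \<and> F l *\<^sub>v v = 0\<^sub>v d}"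
    then have y: "y \<in> carrier_vec d" "F l *\<^sub>v y = complex_of_real 0 \<cdot>\<^sub>v y" by auto
    then have "y = ?P *\<^sub>v y" using F_indicator_mult_vec[OF y, of "\<lambda>r. r = 0"] by simp
    then show "y \<in> (\<lambda>v. ?P *\<^sub>v v) ` carrier_vec d" using y(1) by blast
  qed
qed

text \<open>For one inclusion, a vector in the range is a combination of columns with negative
  eigenvalue. For the other, the vectors fixed by the projector form a submodule containing all
  negative eigenvectors, hence their span.\<close>

lemma neg_projector_F: "neg_projector d (F l) = F (\<lambda>k. if l k < 0 then 1 else 0)"
  unfolding neg_projector_def
proof (rule orth_projector_eqI)
  let ?P = "F (\<lambda>k. if l k < 0 then 1 else 0)"
  let ?N = "{v. \<exists>r::real. r < 0 \<and> eigenvector (F l) v (complex_of_real r)}"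
  interpret vec_space "TYPE(complex)" d .
  have span: "span_vecs d ?N = span ?N" by (simp add: span_vecs_def)
  have N: "?N \<subseteq> carrier_vec d" by (auto simp: eigenvector_def)
  show "hermitian_mat d ?P" by (rule hermitian_F)
  show PP: "?P * ?P = ?P" unfolding F_mult by (rule F_cong) auto
  show "(\<lambda>v. ?P *\<^sub>v v) ` carrier_vec d = span_vecs d ?N"
    unfolding span
  proof (intro subset_antisym subsetI)
    fix y assume "y \<in> (\<lambda>v. ?P *\<^sub>v v) ` carrier_vec d"
    then obtain x where x: "x \<in> carrier_vec d" "y = ?P *\<^sub>v x" by auto
    define w where "w k = complex_of_real (if l k < 0 then 1 else 0) * (mat_adjoint U *\<^sub>v x) $ k" for k
    \<comment> \<open>Induction on the truncation length \<open>m\<close>: each step adds one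
      multiple of a column, which is zero unless its eigenvalue is negative.\<close>
    have "U *\<^sub>v vec d (\<lambda>k. if k < m then w k else 0) \<in> span ?N" if "m \<le> d" for m
      using that
    proof (induction m)
      case 0
      have "U *\<^sub>v vec d (\<lambda>k. if k < 0 then w k else 0) = 0\<^sub>v d"
        using U_carrier by (intro eq_vecI) (auto simp: scalar_prod_def)
      then show ?case using span_zero[of ?N] by (simp add: module_vec_simps)
    next
      case (Suc m)
      then have m: "m < d" by simp
      have "vec d (\<lambda>k. if k < Suc m then w k else 0)
        = vec d (\<lambda>k. if k < m then w k else 0) + w m \<cdot>\<^sub>v unit_vec d m"
        by (rule eq_vecI) (use m in \<open>auto simp: less_Suc_eq\<close>)
      then have "U *\<^sub>v vec d (\<lambda>k. if k < Suc m then w k else 0)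
        = U *\<^sub>v vec d (\<lambda>k. if k < m then w k else 0) + w m \<cdot>\<^sub>v col U m"
        using mult_add_distrib_mat_vec[OF U_carrier vec_carrier smult_carrier_vec[THEN iffD2, OF unit_vec_carrier]]
          mult_mat_vec[OF U_carrier unit_vec_carrier] mult_U_unit_vec[OF m] by simp
      moreover have "w m \<cdot>\<^sub>v col U m \<in> span ?N"
      proof (cases "l m < 0")
        case True
        have "col U m \<noteq> 0\<^sub>v d" using col_U_norm[OF m] by auto
        then have "eigenvector (F l) (col U m) (complex_of_real (l m))"
          using F_mult_col_U[OF m, of l] col_U_carrier[OF m] by (simp add: eigenvector_def)
        then have "col U m \<in> ?N" using True by blast
        then show ?thesis by (intro smult_in_span[OF N] subsetD[OF in_own_span[OF N]])
      next
        case False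
        then have "w m \<cdot>\<^sub>v col U m = 0\<^sub>v d"
          using col_U_carrier[OF m] by (simp add: w_def del: index_mult_mat_vec)
        then show ?thesis using span_zero[of ?N] by (simp add: module_vec_simps)
      qed
      ultimately show ?case
        using Suc.IH m span_add1[OF N] by simp
    qed
    from this[of d] have "U *\<^sub>v vec d (\<lambda>k. if k < d then w k else 0) \<in> span ?N" by simp
    moreover have "vec d (\<lambda>k. if k < d then w k else 0) = vec d w" by (rule eq_vecI) auto
    ultimately show "y \<in> span ?N" using x F_mult_vec[OF x(1)] by (simp add: w_def[abs_def])
  next
    fix y assume "y \<in> span ?N"
    have "?P *\<^sub>v v = v" if "v \<in> ?N" for v
    proof -
      from that obtain r where "r < 0" "v \<in> carrier_vec d" "F l *\<^sub>v v = complex_of_real r \<cdot>\<^sub>v v"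
        by (auto simp: eigenvector_def)
      then show ?thesis using F_indicator_mult_vec[of v l r "\<lambda>r. r < 0"] by simp
    qed
    moreover have P0: "?P *\<^sub>v 0\<^sub>v d = 0\<^sub>v d"
      by (rule eq_vecI) (auto simp: scalar_prod_def)
    ultimately have "?N \<subseteq> {v \<in> carrier_vec d. ?P *\<^sub>v v = v}" using N by blast
    moreover have "LinearCombinations.submodule class_ring {v \<in> carrier_vec d. ?P *\<^sub>v v = v} V"
      unfolding submodule_def using module_axioms P0
      by (auto simp: module_vec_simps mult_add_distrib_mat_vec[OF F_carrier]
          mult_mat_vec[OF F_carrier])
    ultimately have "y \<in> {v \<in> carrier_vec d. ?P *\<^sub>v v = v}"
      using \<open>y \<in> span ?N\<close> span_is_subset by blast
    then show "y \<in> (\<lambda>v. ?P *\<^sub>v v) ` carrier_vec d"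
      by (intro image_eqI[of _ _ y]) auto
  qed
qed

text \<open>The candidate is positive semidefinite with the right square;
  \<open>psd_sqrt_unique\<close> then settles the definite description.\<close>

lemma mat_abs_F: "mat_abs d (F l) = F (\<lambda>k. \<bar>l k\<bar>)"
  unfolding mat_abs_def
proof (rule the_equality)
  have sq: "F (\<lambda>k. \<bar>l k\<bar>) * F (\<lambda>k. \<bar>l k\<bar>) = mat_adjoint (F l) * F l"
    using hermitian_F[of l] by (simp add: F_mult hermitian_mat_def)
  show *: "psd_mat d (F (\<lambda>k. \<bar>l k\<bar>)) \<and>
    F (\<lambda>k. \<bar>l k\<bar>) * F (\<lambda>k. \<bar>l k\<bar>) = mat_adjoint (F l) * F l"
    using sq psd_F by simp
  show "B = F (\<lambda>k. \<bar>l k\<bar>)" if "psd_mat d B \<and> B * B = mat_adjoint (F l) * F l" for B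
    using that * psd_sqrt_unique by metis
qed

lemma neg_plus_half_null_F:
  "neg_projector d (F l) + (1 / 2) \<cdot>\<^sub>m null_projector d (F l)
    = F (\<lambda>k. if l k < 0 then 1 else if l k = 0 then 1 / 2 else 0)"
  using F_smult[of "1 / 2"]
  by (simp add: neg_projector_F null_projector_F F_add) (rule F_cong, simp)

end

section \<open>Guesswork\<close>

lemma psd_mat_carrier: "psd_mat d A \<Longrightarrow> A \<in> carrier_mat d d"
  by (simp add: psd_mat_def hermitian_mat_def)

lemma mat_sum_carrier [simp]: "mat_sum d F I \<in> carrier_mat d d"
  by (simp add: mat_sum_def)

lemma index_mat_sum: "i < d \<Longrightarrow> j < d \<Longrightarrow> mat_sum d F I $$ (i, j) = (\<Sum>k\<in>I. F k $$ (i, j))"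
  by (simp add: mat_sum_def)

lemma mat_trace_mult:
  assumes "A \<in> carrier_mat d d" "B \<in> carrier_mat d d"
  shows "mat_trace (A * B) = (\<Sum>i<d. \<Sum>j<d. A $$ (i, j) * B $$ (j, i))"
  using assms unfolding mat_trace_def
  by (auto simp: mult_mat_index_sum[OF assms] simp del: index_mult_mat(1) intro!: sum.cong)

lemma mat_trace_add:
  assumes "A \<in> carrier_mat d d" "B \<in> carrier_mat d d"
  shows "mat_trace (A + B) = mat_trace A + mat_trace B"
  using assms by (auto simp: mat_trace_def sum.distrib)

lemma mat_trace_uminus:
  assumes "A \<in> carrier_mat d d"
  shows "mat_trace (- A) = - mat_trace A"
  using assms by (auto simp: mat_trace_def sum_negf)

lemma mat_trace_smult_mult:
  assumes "A \<in> carrier_mat d d" "B \<in> carrier_mat d d"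
  shows "mat_trace (c \<cdot>\<^sub>m A * B) = c * mat_trace (A * B)"
  using assms by (simp add: mat_trace_mult[of _ d] sum_distrib_left mult.assoc)

lemma mat_trace_mat_sum_mult:
  assumes "\<And>k. k \<in> I \<Longrightarrow> F k \<in> carrier_mat d d" and B: "B \<in> carrier_mat d d"
  shows "mat_trace (mat_sum d F I * B) = (\<Sum>k\<in>I. mat_trace (F k * B))"
proof -
  have "mat_trace (mat_sum d F I * B) = (\<Sum>i<d. \<Sum>j<d. \<Sum>k\<in>I. F k $$ (i, j) * B $$ (j, i))"
    by (simp add: mat_trace_mult[OF mat_sum_carrier B] index_mat_sum sum_distrib_right)
  also have "\<dots> = (\<Sum>i<d. \<Sum>k\<in>I. \<Sum>j<d. F k $$ (i, j) * B $$ (j, i))"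
    by (rule sum.cong[OF refl], rule sum.swap)
  also have "\<dots> = (\<Sum>k\<in>I. \<Sum>i<d. \<Sum>j<d. F k $$ (i, j) * B $$ (j, i))"
    by (rule sum.swap)
  finally show ?thesis using assms by (simp add: mat_trace_mult[of _ d])
qed

lemma mat_trace_mult_mat_sum:
  assumes A: "A \<in> carrier_mat d d" and "\<And>k. k \<in> I \<Longrightarrow> F k \<in> carrier_mat d d"
  shows "mat_trace (A * mat_sum d F I) = (\<Sum>k\<in>I. mat_trace (A * F k))"
proof -
  have "mat_trace (A * mat_sum d F I) = (\<Sum>i<d. \<Sum>j<d. \<Sum>k\<in>I. A $$ (i, j) * F k $$ (j, i))"
    by (simp add: mat_trace_mult[OF A mat_sum_carrier] index_mat_sum sum_distrib_left)
  also have "\<dots> = (\<Sum>i<d. \<Sum>k\<in>I. \<Sum>j<d. A $$ (i, j) * F k $$ (j, i))"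
    by (rule sum.cong[OF refl], rule sum.swap)
  also have "\<dots> = (\<Sum>k\<in>I. \<Sum>i<d. \<Sum>j<d. A $$ (i, j) * F k $$ (j, i))"
    by (rule sum.swap)
  finally show ?thesis using assms by (simp add: mat_trace_mult[of _ d])
qed

section \<open>Numberings and their reversal\<close>

lemma finite_numberings: "finite M \<Longrightarrow> finite (numberings M)"
  by (rule finite_subset[OF _ finite_PiE[of "{1..card M}" "\<lambda>_. M"]])
    (auto simp: numberings_def bij_betw_def PiE_def)

lemma numberings_mem: "n \<in> numberings M \<Longrightarrow> t \<in> {1..card M} \<Longrightarrow> n t \<in> M"
  by (auto simp: numberings_def bij_betw_def)

lemma reversed_numberings:
  assumes "n \<in> numberings M"
  shows "reversed M n \<in> numberings M"
proof -
  have "bij_betw (\<lambda>t. card M + 1 - t) {1..card M} {1..card M}"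
    by (rule bij_betw_byWitness[where f' = "\<lambda>t. card M + 1 - t"]) auto
  from bij_betw_trans[OF this] have "bij_betw (n \<circ> (\<lambda>t. card M + 1 - t)) {1..card M} M"
    using assms unfolding numberings_def by blast
  then have "bij_betw (reversed M n) {1..card M} M"
    by (rule bij_betw_cong[THEN iffD1, rotated]) (simp add: reversed_def)
  then show ?thesis by (simp add: numberings_def reversed_def)
qed

text \<open>Equality would give the first and the last position the same element, against
  injectivity. It guarantees that the measurement has two separate outcomes to be summed.\<close>

lemma reversed_neq:
  assumes "n \<in> numberings M" "1 < card M"
  shows "reversed M n \<noteq> n"
proof
  assume "reversed M n = n"
  then have "reversed M n 1 = n 1" by simp
  then have "n (card M) = n 1" using assms(2) by (simp add: reversed_def)
  moreover have "inj_on n {1..card M}" using assms(1) by (simp add: numberings_def bij_betw_def)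
  ultimately show False using assms(2) by (auto dest: inj_onD)
qed

section \<open>The operators E(n) and the value of the guesswork\<close>

lemma ensembles_carrier: "\<rho> \<in> ensembles M d \<Longrightarrow> \<rho> \<in> M \<rightarrow> carrier_mat d d"
  by (auto simp: ensembles_def intro: psd_mat_carrier)

lemma E_op_carrier [simp]: "E_op M d \<rho> n \<in> carrier_mat d d"
  by (simp add: E_op_def)

lemma dim_E_op [simp]: "dim_row (E_op M d \<rho> n) = d" "dim_col (E_op M d \<rho> n) = d"
  by (simp_all add: E_op_def mat_sum_def)

lemma index_E_op:
  assumes "\<rho> \<in> M \<rightarrow> carrier_mat d d" "n \<in> numberings M" "i < d" "j < d"
  shows "E_op M d \<rho> n $$ (i, j)
    = (\<Sum>t = 1..card M. complex_of_real (2 * real t - real (card M) - 1) * \<rho> (n t) $$ (i, j))"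
proof -
  have "(c \<cdot>\<^sub>m \<rho> (n t)) $$ (i, j) = c * \<rho> (n t) $$ (i, j)" if "t \<in> {1..card M}" for c t
    using funcset_mem[OF assms(1) numberings_mem[OF assms(2) that]] assms(3,4) by simp
  then show ?thesis
    unfolding E_op_def index_mat_sum[OF assms(3,4)] by (intro sum.cong refl)
qed

text \<open>The substitution t -> |M| + 1 - t negates the weight 2t - |M| - 1.\<close>

lemma E_op_reversed:
  assumes \<rho>: "\<rho> \<in> M \<rightarrow> carrier_mat d d" and n: "n \<in> numberings M"
  shows "E_op M d \<rho> (reversed M n) = - E_op M d \<rho> n"
proof (rule eq_matI)
  fix i j assume "i < dim_row (- E_op M d \<rho> n)" "j < dim_col (- E_op M d \<rho> n)"
  then have ij: "i < d" "j < d" by auto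
  have "E_op M d \<rho> (reversed M n) $$ (i, j)
    = (\<Sum>t = 1..card M. - (complex_of_real (2 * real t - real (card M) - 1) * \<rho> (n t) $$ (i, j)))"
    unfolding index_E_op[OF \<rho> reversed_numberings[OF n] ij]
    by (rule sum.reindex_bij_witness[of _ "\<lambda>t. card M + 1 - t" "\<lambda>t. card M + 1 - t"])
      (auto simp: reversed_def of_nat_diff algebra_simps)
  then show "E_op M d \<rho> (reversed M n) $$ (i, j) = (- E_op M d \<rho> n) $$ (i, j)"
    using ij by (simp add: index_E_op[OF \<rho> n ij] sum_negf)
qed auto

lemma hermitian_E_op:
  assumes \<rho>: "\<rho> \<in> ensembles M d" and n: "n \<in> numberings M"
  shows "hermitian_mat d (E_op M d \<rho> n)"
proof -
  note \<rho>c = ensembles_carrier[OF \<rho>]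
  have herm: "cnj (\<rho> m $$ (j, i)) = \<rho> m $$ (i, j)" if "m \<in> M" "i < d" "j < d" for m i j
  proof -
    have "mat_adjoint (\<rho> m) $$ (i, j) = \<rho> m $$ (i, j)"
      using \<rho> that(1) by (auto simp: ensembles_def psd_mat_def hermitian_mat_def)
    then show ?thesis using funcset_mem[OF \<rho>c that(1)] that by simp
  qed
  have "mat_adjoint (E_op M d \<rho> n) = E_op M d \<rho> n"
  proof (rule eq_matI)
    fix i j assume "i < dim_row (E_op M d \<rho> n)" "j < dim_col (E_op M d \<rho> n)"
    then have ij: "i < d" "j < d" by auto
    then show "mat_adjoint (E_op M d \<rho> n) $$ (i, j) = E_op M d \<rho> n $$ (i, j)"
      using herm[OF numberings_mem[OF n]]
      by (simp add: index_E_op[OF \<rho>c n])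
  qed auto
  then show ?thesis by (simp add: hermitian_mat_def)
qed

text \<open>Write 2t as (2t - |M| - 1) + (|M| + 1). The first part produces \<open>E_op\<close>; the
  second multiplies the total probability, which is 1.\<close>

lemma guesswork_eq:
  assumes \<rho>: "\<rho> \<in> ensembles M d" and \<pi>: "\<pi> \<in> measurements M d"
  shows "guesswork M \<rho> \<pi>
    = (real (card M) + 1 + (\<Sum>n\<in>numberings M. Re (mat_trace (E_op M d \<rho> n * \<pi> n)))) / 2"
proof -
  let ?N = "numberings M" and ?T = "{1..card M}"
  note \<rho>c = funcset_mem[OF ensembles_carrier[OF \<rho>]]
  have \<pi>c: "\<And>n. n \<in> ?N \<Longrightarrow> \<pi> n \<in> carrier_mat d d"
    and tr\<rho>: "(\<Sum>m\<in>M. mat_trace (\<rho> m)) = 1" and sum\<pi>: "mat_sum d \<pi> ?N = 1\<^sub>m d"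
    using \<rho> \<pi> by (auto simp: ensembles_def measurements_def intro: psd_mat_carrier)
  define a where "a n t = Re (mat_trace (\<rho> (n t) * \<pi> n))" for n t
  have E: "Re (mat_trace (E_op M d \<rho> n * \<pi> n)) = (\<Sum>t\<in>?T. (2 * real t - real (card M) - 1) * a n t)"
    if n: "n \<in> ?N" for n
  proof -
    have smult: "mat_trace (c \<cdot>\<^sub>m \<rho> (n t) * \<pi> n) = c * mat_trace (\<rho> (n t) * \<pi> n)"
      if "t \<in> ?T" for c t
      using mat_trace_smult_mult[OF \<rho>c[OF numberings_mem[OF n that]] \<pi>c[OF n]] .
    have "mat_trace (E_op M d \<rho> n * \<pi> n)
      = (\<Sum>t\<in>?T. complex_of_real (2 * real t - real (card M) - 1) * mat_trace (\<rho> (n t) * \<pi> n))"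
      unfolding E_op_def
      using \<rho>c[OF numberings_mem[OF n]] \<pi>c[OF n] smult
      by (subst mat_trace_mat_sum_mult) (auto simp del: of_real_diff of_real_mult intro!: sum.cong)
    then show ?thesis by (simp add: a_def)
  qed
  \<comment> \<open>For fixed \<open>n\<close> the positions run through \<open>M\<close>
    bijectively. The inner sum then no longer depends on the order, and completeness of the
    measurement can be applied for each \<open>m\<close>.\<close>
  have "(\<Sum>n\<in>?N. \<Sum>t\<in>?T. a n t) = (\<Sum>n\<in>?N. \<Sum>m\<in>M. Re (mat_trace (\<rho> m * \<pi> n)))"
    unfolding a_def
    by (intro sum.cong refl sum.reindex_bij_betw) (simp add: numberings_def)
  also have "\<dots> = (\<Sum>m\<in>M. \<Sum>n\<in>?N. Re (mat_trace (\<rho> m * \<pi> n)))"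
    by (rule sum.swap)
  also have "\<dots> = (\<Sum>m\<in>M. Re (mat_trace (\<rho> m)))"
  proof (rule sum.cong[OF refl])
    fix m assume m: "m \<in> M"
    show "(\<Sum>n\<in>?N. Re (mat_trace (\<rho> m * \<pi> n))) = Re (mat_trace (\<rho> m))"
      using mat_trace_mult_mat_sum[OF \<rho>c[OF m], of ?N \<pi>] \<pi>c \<rho>c[OF m] by (simp add: sum\<pi>)
  qed
  finally have total: "(\<Sum>n\<in>?N. \<Sum>t\<in>?T. a n t) = 1"
    using tr\<rho> by (simp flip: Re_sum)
  have "guesswork M \<rho> \<pi> = (\<Sum>n\<in>?N. \<Sum>t\<in>?T. real t * a n t)"
    unfolding guesswork_def guess_prob_def a_def sum_distrib_left by (rule sum.swap)
  moreover have "(\<Sum>n\<in>?N. Re (mat_trace (E_op M d \<rho> n * \<pi> n)))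
    = (\<Sum>n\<in>?N. \<Sum>t\<in>?T. 2 * (real t * a n t) - (real (card M) + 1) * a n t)"
    by (simp add: E algebra_simps)
  moreover have "\<dots> = 2 * (\<Sum>n\<in>?N. \<Sum>t\<in>?T. real t * a n t)
    - (real (card M) + 1) * (\<Sum>n\<in>?N. \<Sum>t\<in>?T. a n t)"
    by (simp add: sum_subtractf sum_distrib_left)
  ultimately show ?thesis using total by simp
qed

text \<open>Weak duality: the bound at the reversed numbering reads A + E(n) \<ge> 0, so its trace
  against \<pi>(n) is nonnegative. Summing over all n, completeness of \<pi> collapses the terms
  with A to the trace of A.\<close>

lemma sum_E_op_lower_bound:
  assumes \<rho>: "\<rho> \<in> M \<rightarrow> carrier_mat d d" and \<pi>: "\<pi> \<in> measurements M d"
    and A: "A \<in> carrier_mat d d"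
    and ge: "\<And>n. n \<in> numberings M \<Longrightarrow> loewner_ge d A (E_op M d \<rho> n)"
  shows "- Re (mat_trace A) \<le> (\<Sum>n\<in>numberings M. Re (mat_trace (E_op M d \<rho> n * \<pi> n)))"
proof -
  let ?N = "numberings M"
  have \<pi>c: "\<And>n. n \<in> ?N \<Longrightarrow> \<pi> n \<in> carrier_mat d d"
    using \<pi> by (auto simp: measurements_def intro: psd_mat_carrier)
  have "- Re (mat_trace A) = (\<Sum>n\<in>?N. - Re (mat_trace (A * \<pi> n)))"
    using mat_trace_mult_mat_sum[OF A, of ?N \<pi>] \<pi>c \<pi> A by (simp add: measurements_def sum_negf)
  also have "\<dots> \<le> (\<Sum>n\<in>?N. Re (mat_trace (E_op M d \<rho> n * \<pi> n)))"
  proof (rule sum_mono)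
    fix n assume n: "n \<in> ?N"
    let ?E = "E_op M d \<rho> n"
    have "A - - ?E = A + ?E"
      by (rule eq_matI) (use A in auto)
    then have "psd_mat d (A + ?E)"
      using ge[OF reversed_numberings[OF n]] by (simp add: loewner_ge_def E_op_reversed[OF \<rho> n])
    then have "0 \<le> Re (mat_trace ((A + ?E) * \<pi> n))"
      using \<pi> n by (intro trace_mult_psd_nonneg) (auto simp: measurements_def)
    also have "\<dots> = Re (mat_trace (A * \<pi> n)) + Re (mat_trace (?E * \<pi> n))"
      using A \<pi>c[OF n] 
      by (simp add: add_mult_distrib_mat[OF A E_op_carrier] mat_trace_add[of _ d] mult_carrier_mat[of _ d d])
    finally show "- Re (mat_trace (A * \<pi> n)) \<le> Re (mat_trace (?E * \<pi> n))" by simp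
  qed
  finally show ?thesis .
qed

text \<open>\<open>LEAST\<close> is informative only when the minimum is attained, so the conclusion
  also states membership and \<open>is_arg_min\<close>.\<close>

theorem theorem1:
  fixes M :: "'m set" and d :: nat and \<rho> :: "'m \<Rightarrow> complex mat" and n' :: "nat \<Rightarrow> 'm"
  assumes "finite M"
    and "card M \<noteq> 1"
    and "\<rho> \<in> ensembles M d"
    and "n' \<in> numberings M"
    and "\<And>n. n \<in> numberings M \<Longrightarrow> loewner_ge d (mat_abs d (E_op M d \<rho> n')) (E_op M d \<rho> n)"
  shows "opt_measurement M d \<rho> n' \<in> measurements M d
       \<and> is_arg_min (guesswork M \<rho>) (\<lambda>\<pi>. \<pi> \<in> measurements M d) (opt_measurement M d \<rho> n')
       \<and> min_guesswork M d \<rho> = guesswork M \<rho> (opt_measurement M d \<rho> n')"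
proof -
  let ?N = "numberings M" and ?\<pi> = "opt_measurement M d \<rho> n'" and ?r = "reversed M n'"
  note \<rho>c = ensembles_carrier[OF assms(3)]
  \<comment> \<open>An empty sum of traces cannot be 1; together with
    \<open>card M \<noteq> 1\<close> this leaves at least two elements.\<close>
  have "M \<noteq> {}" using assms(3) by (auto simp: ensembles_def)
  then have card: "1 < card M" using assms(1,2) by (metis card_0_eq less_one nat_neq_iff)
  have rN: "?r \<in> ?N" and rn: "?r \<noteq> n'"
    using reversed_numberings[OF assms(4)] reversed_neq[OF assms(4) card] by auto
  obtain U l where U: "unitary d U" and E: "E_op M d \<rho> n' = unitary_conj d U l"
    using hermitian_diagonalization[OF hermitian_E_op[OF assms(3,4)]] by blast
  interpret unitary d U by (rule U)
  \<comment> \<open>The same \<open>U\<close> diagonalises both operators, so both outcomes live in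
    one functional calculus.\<close>
  have Er: "E_op M d \<rho> ?r = F (\<lambda>k. - l k)"
    using E_op_reversed[OF \<rho>c assms(4)] E F_uminus by simp
  \<comment> \<open>Two identities matter: g(x) + g(-x) = 1 gives completeness, and x g(x) - x g(-x)
    = -|x| gives the optimal value. The value 1/2 at 0 serves the first.\<close>
  define g :: "real \<Rightarrow> real" where "g x = (if x < 0 then 1 else if x = 0 then 1 / 2 else 0)" for x
  have \<pi>n: "?\<pi> n' = F (\<lambda>k. g (l k))"
    using neg_plus_half_null_F[of l] by (simp add: opt_measurement_def E g_def)
  have \<pi>r: "?\<pi> ?r = F (\<lambda>k. g (- l k))"
    using neg_plus_half_null_F[of "\<lambda>k. - l k"] by (simp add: opt_measurement_def Er g_def)
  have \<pi>0: "?\<pi> n = 0\<^sub>m d d" if "n \<noteq> n'" "n \<noteq> ?r" for n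
    using that by (simp add: opt_measurement_def)
  \<comment> \<open>Kept polymorphic: it is applied to complex matrix entries and to real
    traces.\<close>
  have sum_two: "(\<Sum>n\<in>?N. h n) = h n' + h ?r"
    if "\<And>n. n \<noteq> n' \<Longrightarrow> n \<noteq> ?r \<Longrightarrow> h n = 0" for h :: "(nat \<Rightarrow> 'm) \<Rightarrow> 'b::comm_monoid_add"
  proof -
    have "(\<Sum>n\<in>?N. h n) = (\<Sum>n\<in>{n', ?r}. h n)"
      using finite_numberings[OF assms(1)] assms(4) rN that by (intro sum.mono_neutral_right) auto
    then show ?thesis using rn by auto
  qed
  have "psd_mat d (?\<pi> n)" for n
  proof -
    have "\<exists>f. (\<forall>k. 0 \<le> f k) \<and> ?\<pi> n = F f"
    proof (cases "n = n' \<or> n = ?r")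
      case True
      have "0 \<le> g x" for x by (simp add: g_def)
      then show ?thesis using True \<pi>n \<pi>r by metis
    next
      case False
      then show ?thesis using \<pi>0 F_zero by (intro exI[of _ "\<lambda>k. 0"]) auto
    qed
    then show ?thesis using psd_F by auto
  qed
  moreover have "mat_sum d ?\<pi> ?N = 1\<^sub>m d"
  proof -
    have "mat_sum d ?\<pi> ?N = F (\<lambda>k. g (l k)) + F (\<lambda>k. g (- l k))"
    proof (rule eq_matI)
      fix i j assume "i < dim_row (F (\<lambda>k. g (l k)) + F (\<lambda>k. g (- l k)))"
        "j < dim_col (F (\<lambda>k. g (l k)) + F (\<lambda>k. g (- l k)))"
      then have ij: "i < d" "j < d" by auto
      have "(\<Sum>n\<in>?N. ?\<pi> n $$ (i, j)) = ?\<pi> n' $$ (i, j) + ?\<pi> ?r $$ (i, j)"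
        by (rule sum_two) (use \<pi>0 ij in auto)
      then show "mat_sum d ?\<pi> ?N $$ (i, j) = (F (\<lambda>k. g (l k)) + F (\<lambda>k. g (- l k))) $$ (i, j)"
        using ij by (simp add: index_mat_sum \<pi>n \<pi>r)
    qed (auto simp: mat_sum_def)
    also have "\<dots> = F (\<lambda>k. 1)" unfolding F_add by (rule F_cong) (simp add: g_def)
    finally show ?thesis by (simp add: F_one)
  qed
  ultimately have meas: "?\<pi> \<in> measurements M d" by (simp add: measurements_def)
  have abs: "mat_abs d (E_op M d \<rho> n') = F (\<lambda>k. \<bar>l k\<bar>)" by (simp add: E mat_abs_F)
  have tr0: "mat_trace (E_op M d \<rho> n * 0\<^sub>m d d) = 0" for n
    by (simp add: mat_trace_def right_mult_zero_mat[OF E_op_carrier])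
  have "(\<Sum>n\<in>?N. Re (mat_trace (E_op M d \<rho> n * ?\<pi> n)))
    = Re (mat_trace (F l * F (\<lambda>k. g (l k)))) + Re (mat_trace (F (\<lambda>k. - l k) * F (\<lambda>k. g (- l k))))"
    using sum_two[of "\<lambda>n. Re (mat_trace (E_op M d \<rho> n * ?\<pi> n))"] \<pi>0 tr0
    by (simp add: \<pi>n \<pi>r E Er)
  also have "\<dots> = Re (mat_trace (F (\<lambda>k. l k * g (l k)) + F (\<lambda>k. - l k * g (- l k))))"
    by (simp add: F_mult mat_trace_add[OF F_carrier F_carrier])
  also have "F (\<lambda>k. l k * g (l k)) + F (\<lambda>k. - l k * g (- l k)) = - F (\<lambda>k. \<bar>l k\<bar>)"
    unfolding F_add F_uminus by (rule F_cong) (simp add: g_def)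
  finally have opt: "(\<Sum>n\<in>?N. Re (mat_trace (E_op M d \<rho> n * ?\<pi> n)))
    = - Re (mat_trace (F (\<lambda>k. \<bar>l k\<bar>)))"
    by (simp add: mat_trace_uminus[OF F_carrier])
  \<comment> \<open>By \<open>guesswork_eq\<close> both sides are the same increasing affine
    function of their trace sums, so comparing those sums suffices.\<close>
  have le: "guesswork M \<rho> ?\<pi> \<le> guesswork M \<rho> \<pi>" if \<pi>: "\<pi> \<in> measurements M d" for \<pi>
  proof -
    have "- Re (mat_trace (F (\<lambda>k. \<bar>l k\<bar>)))
      \<le> (\<Sum>n\<in>?N. Re (mat_trace (E_op M d \<rho> n * \<pi> n)))"
      by (rule sum_E_op_lower_bound[OF \<rho>c \<pi> F_carrier]) (use assms(5) abs in metis)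
    then have "(\<Sum>n\<in>?N. Re (mat_trace (E_op M d \<rho> n * ?\<pi> n)))
      \<le> (\<Sum>n\<in>?N. Re (mat_trace (E_op M d \<rho> n * \<pi> n)))"
      by (simp only: opt)
    then show ?thesis
      by (simp only: guesswork_eq[OF assms(3) meas] guesswork_eq[OF assms(3) \<pi>]) simp
  qed
  have "min_guesswork M d \<rho> = guesswork M \<rho> ?\<pi>"
    unfolding min_guesswork_def by (rule Least_equality) (use meas le in auto)
  then show ?thesis using meas le by (auto simp: is_arg_min_linorder)
qed

end
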